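(* Let $d_X,d_Y\in\mathbb{N}$, $\mathcal{X}=\mathbb{R}^{d_X}$, $\mathcal{Y}=\mathbb{R}^{d_Y}$. Let $p(x)=n(x;m^f,P^f)$ be a Gaussian prior density on $\mathcal{X}$ and $p(y|x)=n(y;Hx,R)$ a Gaussian likelihood on $\mathcal{Y}$, where $m^f\in\mathbb{R}^{d_X}$, $H\in\mathbb{R}^{d_Y\times d_X}$, and $P^f\in\mathbb{R}^{d_X\times d_X}$, $R\in\mathbb{R}^{d_Y\times d_Y}$ are symmetric positive definite. Let $k:\mathcal{Y}\to(0,1]$ be differentiable, put $w(y)=k(y)R^{1/2}$, and assume the true data generating density $\pi$ on $\mathcal{Y}$ satisfies the regularity conditions (stated in the context) with respect to $p(\cdot|x)$ and $w$. Then for every fixed observation $y\in\mathcal{Y}$ the diffusion score matching (DSM) posterior is Gaussian, $$p_{\mathrm{DSM}}(x|y)=n(x;m^a,P^a),$$ where $$N(y)=\frac{1}{2k^2(y)}R,\qquad \tilde y=y-2N(y)\nabla_y k^2(y),\qquad \widetilde K(y)=P^fH^T\left[N(y)+HP^fH^T\right]^{-1},$$ $$P^a=P^f-\widetilde K(y)HP^f,\qquad m^a=m^f-\widetilde K(y)\left[Hm^f-\tilde y\right].$$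
   Context: $n(x;m,P)$ denotes the density of the multivariate Gaussian distribution with mean $m$ and covariance $P$; $R^{1/2}$ is the symmetric positive definite square root; $k^2(y)=(k(y))^2$. Score: $s_{p(\cdot|x)}(y)=\nabla_y\log p(y|x)$, and $s_\pi(y)=\nabla_y\log\pi(y)$. For a point-wise invertible matrix-valued function $w:\mathcal{Y}\to\mathbb{R}^{d_Y\times d_Y}$, the one-sample diffusion score matching estimator at $y$ is $$\widehat{\mathrm{DSM}}(x,y)=\left\|w^T(y)s_{p(\cdot|x)}(y)\right\|_2^2+2\,\nabla_y\cdot\left(w(y)w^T(y)s_{p(\cdot|x)}(y)\right),$$ where $\nabla_y\cdot$ is the divergence. The DSM posterior is the probability density in $x$ with $$p_{\mathrm{DSM}}(x|y)\propto p(x)\exp\left[-\widehat{\mathrm{DSM}}(x,y)\right].$$ Regularity conditions on $\pi$: for every $x\in\mathcal{X}$, $\int_{\mathcal{Y}}\pi(y)\|s_{p(\cdot|x)}(y)-s_\pi(y)\|^2\,\mathrm{d}y<\infty$, and both $\pi\, ww^Ts_{p(\cdot|x)}$ and $\nabla\cdot(\pi\, ww^Ts_{p(\cdot|x)})$ belong to $L^1(\mathbb{R}^{d_Y})$. *)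

theory Defs
  imports "HOL-Analysis.Analysis"
begin

definition sym_pos_def :: "real^'n^'n \<Rightarrow> bool" where
  "sym_pos_def A \<longleftrightarrow> transpose A = A \<and> (\<forall>v. v \<noteq> 0 \<longrightarrow> v \<bullet> (A *v v) > 0)"

definition matrix_sqrt :: "real^'n^'n \<Rightarrow> real^'n^'n" where
  "matrix_sqrt A = (THE S. sym_pos_def S \<and> S ** S = A)"

definition gauss_density :: "real^'n \<Rightarrow> real^'n \<Rightarrow> real^'n^'n \<Rightarrow> real" where
  "gauss_density x m P =
     exp (- (1 / 2) * ((x - m) \<bullet> (matrix_inv P *v (x - m)))) / sqrt ((2 * pi) ^ CARD('n) * det P)"

definition grad :: "(real^'n \<Rightarrow> real) \<Rightarrow> real^'n \<Rightarrow> real^'n" where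
  "grad f y = (\<chi> i. frechet_derivative f (at y) (axis i 1))"

definition divergence :: "(real^'n \<Rightarrow> real^'n) \<Rightarrow> real^'n \<Rightarrow> real" where
  "divergence F y = (\<Sum>i\<in>UNIV. frechet_derivative F (at y) (axis i 1) $ i)"

definition score :: "(real^'n \<Rightarrow> real) \<Rightarrow> real^'n \<Rightarrow> real^'n" where
  "score q = grad (\<lambda>y. ln (q y))"

definition prob_density :: "(real^'n \<Rightarrow> real) \<Rightarrow> bool" where
  "prob_density q \<longleftrightarrow>
     (\<forall>y. 0 \<le> q y) \<and> integrable lebesgue q \<and> integral\<^sup>L lebesgue q = 1"

text \<open>Throughout, a likelihood \<open>lik\<close> is read as \<open>lik x y = p(y | x)\<close>.\<close>

definition dsm :: "(real^'n \<Rightarrow> real^'n^'n) \<Rightarrow> ('x \<Rightarrow> real^'n \<Rightarrow> real) \<Rightarrow> 'x \<Rightarrow> real^'n \<Rightarrow> real" where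
  "dsm w lik x y =
     (norm (transpose (w y) *v score (lik x) y))\<^sup>2
     + 2 * divergence (\<lambda>z. (w z ** transpose (w z)) *v score (lik x) z) y"

text \<open>If the unnormalised posterior is not integrable, its integral and hence the quotient below
  are \<open>0\<close>; so an equation with a strictly positive function also says that the posterior exists.\<close>

definition dsm_posterior ::
    "(real^'m \<Rightarrow> real) \<Rightarrow> (real^'n \<Rightarrow> real^'n^'n) \<Rightarrow> (real^'m \<Rightarrow> real^'n \<Rightarrow> real)
      \<Rightarrow> real^'n \<Rightarrow> real^'m \<Rightarrow> real" where
  "dsm_posterior prior w lik y x =
     prior x * exp (- dsm w lik x y)
     / integral\<^sup>L lebesgue (\<lambda>x'. prior x' * exp (- dsm w lik x' y))"

definition dsm_regular ::
    "(real^'n \<Rightarrow> real) \<Rightarrow> (real^'n \<Rightarrow> real^'n^'n) \<Rightarrow> ('x \<Rightarrow> real^'n \<Rightarrow> real) \<Rightarrow> bool" where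
  "dsm_regular \<pi> w lik \<longleftrightarrow>
     (\<forall>x.
        integrable lebesgue (\<lambda>y. \<pi> y * (norm (score (lik x) y - score \<pi> y))\<^sup>2)
      \<and> integrable lebesgue (\<lambda>y. \<pi> y *\<^sub>R ((w y ** transpose (w y)) *v score (lik x) y))
      \<and> integrable lebesgue
          (divergence (\<lambda>y. \<pi> y *\<^sub>R ((w y ** transpose (w y)) *v score (lik x) y))))"

end

theory Submission
  imports Defs "HOL-Probability.Distributions"
begin

text \<open>
  The score of the likelihood is \<open>- R\<^sup>-\<^sup>1 (y - H x)\<close> and \<open>w w\<^sup>T = k\<^sup>2 R\<close>, so the field under the divergence is
  \<open>- k\<^sup>2 (y - H x)\<close> and the estimator is a quadratic polynomial in \<open>H x\<close>. Completing the square in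
  \<open>y - H x\<close> turns it into the negative log-likelihood of a Gaussian observation \<open>y - 2 N \<nabla>k\<^sup>2\<close> with
  covariance \<open>N\<close>, up to a constant. The posterior is then that of a linear Gaussian model, with
  information matrix \<open>P\<^sup>-\<^sup>1 + H\<^sup>T N\<^sup>-\<^sup>1 H\<close>, whose inverse is the Kalman covariance. The normalising
  constant is the Gaussian integral, computed by the substitution \<open>x = P\<^sup>1\<^sup>/\<^sup>2 z\<close>. The square
  root of a positive definite \<open>A\<close> comes from the contraction \<open>Y \<mapsto> (B + Y\<^sup>2) / 2\<close> with \<open>B = I - c A\<close> for
  small \<open>c\<close>.
\<close>

section \<open>Positive definite matrices and their square roots\<close>

lemma inner_matrix_vector_symmetric:
  fixes A :: "real^'n^'n"
  assumes "transpose A = A"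
  shows "(A *v x) \<bullet> y = x \<bullet> (A *v y)"
  using dot_lmul_matrix[of x A y] by (metis assms transpose_matrix_vector)

lemma symmetric_matrixI:
  fixes A :: "real^'n^'n"
  assumes "\<And>x y. (A *v x) \<bullet> y = x \<bullet> (A *v y)"
  shows "transpose A = A"
proof -
  have "A $ j $ i = A $ i $ j" for i j
    using assms[of "axis i 1" "axis j 1"]
    by (simp add: matrix_vector_mult_basis inner_axis inner_axis' column_def)
  then show ?thesis
    by (simp add: transpose_def vec_eq_iff)
qed

lemma sym_pos_def_transpose: "sym_pos_def A \<Longrightarrow> transpose A = A"
  by (simp add: sym_pos_def_def)

lemma sym_pos_def_inner_pos: "sym_pos_def A \<Longrightarrow> v \<noteq> 0 \<Longrightarrow> v \<bullet> (A *v v) > 0"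
  by (simp add: sym_pos_def_def)

lemma sym_pos_def_inner_nonneg: "sym_pos_def A \<Longrightarrow> v \<bullet> (A *v v) \<ge> 0"
  by (cases "v = 0") (auto intro: less_imp_le sym_pos_def_inner_pos)

lemma sym_pos_def_invertible:
  assumes "sym_pos_def A"
  shows "invertible A"
proof -
  have "x = 0" if "A *v x = 0" for x
    using sym_pos_def_inner_pos[OF assms, of x] that by fastforce
  then show ?thesis
    by (metis invertible_left_inverse matrix_left_invertible_ker)
qed

lemma
  fixes A :: "real^'n^'n"
  assumes "invertible A"
  shows matrix_inv_right: "A ** matrix_inv A = mat 1"
    and matrix_inv_left: "matrix_inv A ** A = mat 1"
proof -
  have "\<exists>B. A ** B = mat 1 \<and> B ** A = mat 1"
    using assms by (auto simp: invertible_def)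
  from someI_ex[OF this] show "A ** matrix_inv A = mat 1" "matrix_inv A ** A = mat 1"
    by (auto simp: matrix_inv_def)
qed

lemma matrix_inv_unique:
  fixes A B :: "real^'n^'n"
  assumes "A ** B = mat 1"
  shows "matrix_inv A = B"
proof -
  have "invertible A"
    using assms invertible_right_inverse by blast
  then show ?thesis
    by (metis assms matrix_inv_left matrix_mul_assoc matrix_mul_lid matrix_mul_rid)
qed

lemma
  assumes "sym_pos_def A"
  shows sym_pos_def_inv_mult_vector: "matrix_inv A *v (A *v v) = v"
    and sym_pos_def_mult_inv_vector: "A *v (matrix_inv A *v v) = v"
  by (simp_all add: matrix_vector_mul_assoc matrix_inv_left matrix_inv_right
      sym_pos_def_invertible[OF assms])

text \<open>Transposing \<open>B ** A = mat 1\<close> shows that the transpose of \<open>B\<close>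
  is also an inverse of \<open>A\<close>. Positivity follows from writing \<open>v\<close> as
  \<open>A *v (B *v v)\<close>.\<close>

lemma sym_pos_def_matrix_inv:
  assumes "sym_pos_def A"
  shows "sym_pos_def (matrix_inv A)"
proof -
  let ?B = "matrix_inv A"
  have inv: "A ** ?B = mat 1" "?B ** A = mat 1"
    using sym_pos_def_invertible[OF assms] by (simp_all add: matrix_inv_right matrix_inv_left)
  have "?B = transpose ?B"
    using inv matrix_transpose_mul[of ?B A] sym_pos_def_transpose[OF assms]
    by (intro matrix_inv_unique) (simp add: transpose_mat)
  moreover have "v \<bullet> (?B *v v) > 0" if "v \<noteq> 0" for v
    using sym_pos_def_inner_pos[OF assms, of "?B *v v"] that sym_pos_def_mult_inv_vector[OF assms]
    by (metis inner_commute matrix_vector_mult_0_right)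
  ultimately show ?thesis
    by (simp add: sym_pos_def_def)
qed

text \<open>The quadratic form attains a positive minimum on the compact unit sphere, and
  homogeneity of degree 2 carries it to all \<open>x\<close>.\<close>

lemma sym_pos_def_coercive:
  fixes A :: "real^'n^'n"
  assumes "sym_pos_def A"
  obtains l where "l > 0" "\<And>x. l * (norm x)\<^sup>2 \<le> x \<bullet> (A *v x)"
proof -
  have "continuous_on (sphere 0 1) (\<lambda>x. x \<bullet> (A *v x))"
    by (intro continuous_intros linear_continuous_on) (simp add: linear_linear)
  moreover have "sphere (0::real^'n) 1 \<noteq> {}"
    by simp
  ultimately obtain u where u: "u \<in> sphere 0 1" "\<And>x. x \<in> sphere 0 1 \<Longrightarrow> u \<bullet> (A *v u) \<le> x \<bullet> (A *v x)"
    using continuous_attains_inf[of "sphere (0::real^'n) 1"] by (meson compact_sphere)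
  let ?l = "u \<bullet> (A *v u)"
  have "?l * (norm x)\<^sup>2 \<le> x \<bullet> (A *v x)" for x
  proof (cases "x = 0")
    case False
    have "?l \<le> (x /\<^sub>R norm x) \<bullet> (A *v (x /\<^sub>R norm x))"
      using False by (intro u(2)) simp
    also have "\<dots> = (x \<bullet> (A *v x)) / (norm x)\<^sup>2"
      by (simp add: matrix_vector_mult_scaleR power2_eq_square divide_inverse)
    finally show ?thesis
      using False by (simp add: field_simps)
  qed simp
  moreover have "?l > 0"
    using u(1) by (intro sym_pos_def_inner_pos[OF assms]) auto
  ultimately show thesis
    using that by blast
qed

text \<open>The sum and the difference of two roots anticommute,
  \<open>A D + D A = 2 (S S - T T) = 0\<close>, and positivity of the sum then forces the difference
  to vanish. No spectral decomposition enters.\<close>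

lemma sym_pos_def_sqrt_unique:
  fixes S T :: "real^'n^'n"
  assumes "sym_pos_def S" "sym_pos_def T" "S ** S = T ** T"
  shows "S = T"
proof -
  define A D where "A = S + T" and "D = S - T"
  have symD: "transpose D = D"
    using assms(1,2) by (simp add: D_def sym_pos_def_def transpose_def vec_eq_iff)
  have Apos: "v \<noteq> 0 \<Longrightarrow> v \<bullet> (A *v v) > 0" for v
    using sym_pos_def_inner_pos[OF assms(1), of v] sym_pos_def_inner_pos[OF assms(2), of v]
    by (simp add: A_def matrix_vector_mult_add_rdistrib inner_add_right)
  have AD: "A ** D + D ** A = 0"
    using assms(3)
    by (simp add: A_def D_def matrix_eq matrix_vector_mult_add_rdistrib matrix_vector_mult_diff_rdistrib
        matrix_vector_mult_diff_distrib vec.add flip: matrix_vector_mul_assoc)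
  \<comment> \<open>Hence \<open>tr (D A D) = - tr (D D A) = - tr (D A D)\<close>, so the nonnegative numbers
    \<open>D e\<^sub>i \<bullet> A D e\<^sub>i\<close> sum to zero.\<close>
  have "trace (D ** A ** D) = trace (D ** (D ** A))"
    by (metis trace_mul_sym)
  moreover have "D ** A ** D + D ** (D ** A) = D ** (A ** D + D ** A)"
    by (simp add: matrix_add_ldistrib matrix_mul_assoc)
  ultimately have "2 * trace (D ** A ** D) = trace (0 :: real^'n^'n)"
    using AD trace_add[of "D ** A ** D" "D ** (D ** A)"] by (simp add: matrix_mul_assoc)
  then have "trace (D ** A ** D) = 0"
    by (simp add: trace_def)
  moreover have "(D ** A ** D) $ i $ i = (D *v axis i 1) \<bullet> (A *v (D *v axis i 1))" for i
  proof -
    have "(D ** A ** D) $ i $ i = axis i 1 \<bullet> ((D ** A ** D) *v axis i 1)"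
      by (simp add: matrix_vector_mult_basis inner_axis' column_def)
    also have "\<dots> = axis i 1 \<bullet> (D *v (A *v (D *v axis i 1)))"
      by (simp add: matrix_vector_mul_assoc matrix_mul_assoc)
    finally show ?thesis
      by (simp add: inner_matrix_vector_symmetric[OF symD])
  qed
  ultimately have "(\<Sum>i\<in>UNIV. (D *v axis i 1) \<bullet> (A *v (D *v axis i 1))) = 0"
    by (simp add: trace_def)
  moreover have "0 \<le> v \<bullet> (A *v v)" for v
    by (cases "v = 0") (auto intro: less_imp_le Apos)
  ultimately have "(D *v axis i 1) \<bullet> (A *v (D *v axis i 1)) = 0" for i
    by (simp add: sum_nonneg_eq_0_iff)
  then have "D *v axis i 1 = 0" for i
    by (metis Apos less_irrefl)
  then have "D = 0"
    by (simp add: matrix_vector_mult_basis column_def vec_eq_iff)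
  then show ?thesis
    by (simp add: D_def)
qed

text \<open>Here \<open>Y\<close> is the identity minus a root of \<open>I - B\<close>. Bounded
  linear maps form a complete space with a submultiplicative norm, which suits Banach's fixed point
  theorem.\<close>

lemma blinfun_one_minus_sqrt_exists:
  fixes B :: "(real^'n) \<Rightarrow>\<^sub>L (real^'n)"
  assumes sym: "\<And>x y. B x \<bullet> y = x \<bullet> B y" and B: "norm B < 1"
  obtains Y :: "(real^'n) \<Rightarrow>\<^sub>L (real^'n)"
  where "norm Y < 1" "\<And>x y. Y x \<bullet> y = x \<bullet> Y y" "\<And>x. 2 *\<^sub>R Y x = B x + Y (Y x)"
proof -
  define s where "s = {Y :: (real^'n) \<Rightarrow>\<^sub>L (real^'n). norm Y \<le> norm B
    \<and> (\<forall>x y. blinfun_apply Y x \<bullet> y = x \<bullet> blinfun_apply Y y)}"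
  define f where "f Y = (1/2) *\<^sub>R (B + (Y o\<^sub>L Y))" for Y
  have "s = cball 0 (norm B) \<inter> (\<Inter>x. \<Inter>y. {Y. blinfun_apply Y x \<bullet> y = x \<bullet> blinfun_apply Y y})"
    by (auto simp: s_def)
  also have "closed \<dots>"
    by (intro closed_Int closed_INT ballI closed_Collect_eq continuous_intros closed_cball)
  finally have "complete s"
    by (simp add: complete_eq_closed)
  moreover have "s \<noteq> {}"
    using sym by (auto simp: s_def)
  moreover have "f ` s \<subseteq> s"
  proof (intro image_subsetI)
    fix Y assume Y: "Y \<in> s"
    \<comment> \<open>Since \<open>norm B < 1\<close>, squaring does not leave the ball of radius
      \<open>norm B\<close>; the average of two elements of that ball stays inside.\<close>
    have "norm (Y o\<^sub>L Y) \<le> norm B * 1"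
      using Y B by (intro order_trans[OF norm_blinfun_compose] mult_mono) (auto simp: s_def)
    then have "norm (B + (Y o\<^sub>L Y)) \<le> 2 * norm B"
      using norm_triangle_ineq[of B "Y o\<^sub>L Y"] by simp
    then have "norm (f Y) \<le> norm B"
      by (simp add: f_def)
    moreover have "f Y x \<bullet> y = x \<bullet> f Y y" for x y
      using Y sym by (simp add: f_def s_def blinfun.bilinear_simps inner_add_left inner_add_right)
    ultimately show "f Y \<in> s"
      by (simp add: s_def)
  qed
  moreover have "dist (f Y) (f Z) \<le> norm B * dist Y Z" if "Y \<in> s" "Z \<in> s" for Y Z
  proof -
    \<comment> \<open>A noncommutative difference of squares: each summand contributes a factor
      \<open>norm B\<close>, and the 1/2 in \<open>f\<close> leaves the contraction constant
      \<open>norm B\<close>.\<close>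
    have eq: "(Y o\<^sub>L Y) - (Z o\<^sub>L Z) = (Y o\<^sub>L (Y - Z)) + ((Y - Z) o\<^sub>L Z)"
      by (intro blinfun_eqI) (simp add: blinfun.bilinear_simps)
    have "norm (Y o\<^sub>L (Y - Z)) \<le> norm B * norm (Y - Z)" "norm ((Y - Z) o\<^sub>L Z) \<le> norm (Y - Z) * norm B"
      using that by (auto intro!: order_trans[OF norm_blinfun_compose] mult_mono simp: s_def)
    then have "norm ((Y o\<^sub>L Y) - (Z o\<^sub>L Z)) \<le> 2 * (norm B * norm (Y - Z))"
      unfolding eq using norm_triangle_ineq[of "Y o\<^sub>L (Y - Z)" "(Y - Z) o\<^sub>L Z"] by (simp add: mult.commute)
    moreover have "f Y - f Z = (1/2) *\<^sub>R ((Y o\<^sub>L Y) - (Z o\<^sub>L Z))"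
      by (simp add: f_def algebra_simps)
    ultimately show ?thesis
      by (simp add: dist_norm)
  qed
  ultimately obtain Y where "Y \<in> s" "f Y = Y"
    using Banach_fix[of s "norm B" f] B by (metis norm_ge_zero)
  moreover have "2 *\<^sub>R Y x = B x + Y (Y x)" for x
  proof -
    have "f Y x = (1/2) *\<^sub>R (B x + Y (Y x))"
      by (simp add: f_def blinfun.bilinear_simps)
    then have "2 *\<^sub>R f Y x = B x + Y (Y x)"
      by simp
    then show ?thesis
      by (simp add: \<open>f Y = Y\<close>)
  qed
  ultimately show thesis
    using that[of Y] B by (auto simp: s_def)
qed

text \<open>A suitable multiple \<open>c A\<close> lies at operator distance below 1 from the
  identity, so \<open>c A\<close> has a root by the fixed point lemma; dividing it by
  \<open>sqrt c\<close> gives the root of \<open>A\<close>.\<close>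

lemma sym_pos_def_sqrt_exists:
  fixes A :: "real^'n^'n"
  assumes A: "sym_pos_def A"
  obtains S where "sym_pos_def S" "S ** S = A"
proof -
  obtain l where l: "l > 0" "\<And>x. l * (norm x)\<^sup>2 \<le> x \<bullet> (A *v x)"
    using sym_pos_def_coercive[OF A] by blast
  obtain M where M: "M > 0" "\<And>x. norm (A *v x) \<le> norm x * M"
    using bounded_linear.pos_bounded[OF matrix_vector_mul_bounded_linear[of A]] by blast
  \<comment> \<open>This value minimises \<open>1 - 2 c l + c^2 M^2\<close>, the bound on the
    squared norm of \<open>I - c A\<close>.\<close>
  define c where "c = l / M\<^sup>2"
  have c: "c > 0"
    using l M by (simp add: c_def)
  define B where "B = Blinfun (\<lambda>x. x - c *\<^sub>R (A *v x))"
  have B: "blinfun_apply B x = x - c *\<^sub>R (A *v x)" for x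
    unfolding B_def
    by (subst bounded_linear_Blinfun_apply)
       (auto intro!: bounded_linear_intros matrix_vector_mul_bounded_linear)
  have Bx: "(norm (B x))\<^sup>2 \<le> (1 - l\<^sup>2 / M\<^sup>2) * (norm x)\<^sup>2" for x
  proof -
    have "(norm (A *v x))\<^sup>2 \<le> (norm x * M)\<^sup>2"
      using M(2) by (intro power_mono) auto
    then have 1: "c\<^sup>2 * (norm (A *v x))\<^sup>2 \<le> c\<^sup>2 * (norm x * M)\<^sup>2"
      by (intro mult_left_mono) auto
    have 2: "2 * c * (l * (norm x)\<^sup>2) \<le> 2 * c * (x \<bullet> (A *v x))"
      using l(2) c by (intro mult_left_mono) auto
    have "(norm (B x))\<^sup>2 = (norm x)\<^sup>2 - 2 * c * (x \<bullet> (A *v x)) + c\<^sup>2 * (norm (A *v x))\<^sup>2"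
      unfolding B power2_norm_eq_inner
      by (simp add: inner_diff_left inner_diff_right inner_commute power2_eq_square algebra_simps)
    also have "\<dots> \<le> (norm x)\<^sup>2 - 2 * c * (l * (norm x)\<^sup>2) + c\<^sup>2 * (norm x * M)\<^sup>2"
      using 1 2 by linarith
    also have "\<dots> = (1 - l\<^sup>2 / M\<^sup>2) * (norm x)\<^sup>2"
      using M(1) by (simp add: c_def field_simps power2_eq_square)
    finally show ?thesis .
  qed
  define b where "b = sqrt (1 - l\<^sup>2 / M\<^sup>2)"
  \<comment> \<open>Any unit vector inserted in the bound \<open>Bx\<close> shows that the radicand
    is nonnegative.\<close>
  have "0 \<le> 1 - l\<^sup>2 / M\<^sup>2"
    using order_trans[OF zero_le_power2 Bx[of "axis undefined 1"]] by simp
  moreover have "0 < l\<^sup>2 / M\<^sup>2"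
    using l M by simp
  ultimately have b: "0 \<le> b" "b < 1" "b\<^sup>2 = 1 - l\<^sup>2 / M\<^sup>2"
    by (auto simp: b_def)
  have "norm (B x) \<le> b * norm x" for x
    by (rule power2_le_imp_le) (use Bx[of x] b in \<open>auto simp: power_mult_distrib\<close>)
  then have "norm B < 1"
    using b norm_blinfun_bound[of b B] by fastforce
  moreover have "B x \<bullet> y = x \<bullet> B y" for x y
    using inner_matrix_vector_symmetric[OF sym_pos_def_transpose[OF A]]
    by (simp add: B inner_diff_left inner_diff_right)
  ultimately obtain Y :: "(real^'n) \<Rightarrow>\<^sub>L (real^'n)" where Y: "norm Y < 1" "\<And>x y. Y x \<bullet> y = x \<bullet> Y y"
    "\<And>x. 2 *\<^sub>R Y x = B x + Y (Y x)"
    using blinfun_one_minus_sqrt_exists by blast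
  \<comment> \<open>The fixed point equation says \<open>(I - Y)\<^sup>2 = I - B = c A\<close>.\<close>
  define S where "S = matrix (\<lambda>x. (1 / sqrt c) *\<^sub>R (x - Y x))"
  have S: "S *v x = (1 / sqrt c) *\<^sub>R (x - Y x)" for x
    unfolding S_def
    by (rule matrix_works, unfold linear_matrix_vector_mul_eq)
       (auto intro!: linearI simp: blinfun.bilinear_simps algebra_simps)
  have "transpose S = S"
    by (intro symmetric_matrixI) (simp add: S inner_diff_left inner_diff_right Y(2))
  moreover have "x \<bullet> (S *v x) > 0" if "x \<noteq> 0" for x
  proof -
    \<comment> \<open>\<open>norm Y < 1\<close> makes \<open>I - Y\<close> positive
      definite.\<close>
    have "x \<bullet> Y x \<le> norm x * norm (Y x)"
      by (rule norm_cauchy_schwarz)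
    also have "\<dots> \<le> norm x * (norm Y * norm x)"
      by (intro mult_left_mono norm_blinfun) auto
    also have "\<dots> < norm x * (1 * norm x)"
      using that Y(1) by (intro mult_strict_left_mono mult_strict_right_mono) auto
    also have "\<dots> = x \<bullet> x"
      by (simp add: dot_square_norm power2_eq_square)
    finally show ?thesis
      using c by (simp add: S inner_diff_right)
  qed
  moreover have "S ** S = A"
  proof -
    have "(S ** S) *v x = A *v x" for x
    proof -
      have "(S ** S) *v x = (1 / sqrt c) *\<^sub>R ((1 / sqrt c) *\<^sub>R (x - 2 *\<^sub>R Y x + Y (Y x)))"
        by (simp add: matrix_vector_mul_assoc[symmetric] S blinfun.bilinear_simps scaleR_2 algebra_simps)
      also have "\<dots> = (1 / c) *\<^sub>R (x - 2 *\<^sub>R Y x + Y (Y x))"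
        using c by simp
      also have "x - 2 *\<^sub>R Y x + Y (Y x) = c *\<^sub>R (A *v x)"
        unfolding Y(3) by (simp add: B)
      finally show ?thesis
        using c by simp
    qed
    then show ?thesis
      by (simp add: matrix_eq)
  qed
  ultimately show thesis
    using that[of S] by (simp add: sym_pos_def_def)
qed

text \<open>Existence and uniqueness together justify the definite description in
  \<open>matrix_sqrt\<close>.\<close>

lemma
  assumes "sym_pos_def A"
  shows sym_pos_def_matrix_sqrt: "sym_pos_def (matrix_sqrt A)"
    and matrix_sqrt_square: "matrix_sqrt A ** matrix_sqrt A = A"
proof -
  have "\<exists>!S. sym_pos_def S \<and> S ** S = A"
    by (metis assms sym_pos_def_sqrt_exists sym_pos_def_sqrt_unique)
  from theI'[OF this] show "sym_pos_def (matrix_sqrt A)" "matrix_sqrt A ** matrix_sqrt A = A"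
    by (auto simp: matrix_sqrt_def)
qed

section \<open>Linear change of variables\<close>

lemma nn_integral_lborel_stretch:
  fixes c :: "'n::finite \<Rightarrow> real" and h :: "real^'n \<Rightarrow> ennreal"
  assumes c: "\<And>i. c i \<noteq> 0" and [measurable]: "h \<in> borel_measurable borel"
  shows "(\<integral>\<^sup>+x. h x \<partial>lborel) = ennreal \<bar>prod c UNIV\<bar> * (\<integral>\<^sup>+x. h (\<chi> i. c i * x $ i) \<partial>lborel)"
proof -
  have axis_nth_eq: "axis i (1::real) $ j = (if j = i then 1 else 0)" for i j :: 'n
    by (simp add: axis_def)
  \<comment> \<open>The affine rule for \<open>lborel\<close> takes one factor per basis vector, so
    \<open>d\<close> re-indexes \<open>c\<close>; the choice is determined because distinct indices
    give distinct axes.\<close>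
  define d :: "real^'n \<Rightarrow> real" where "d b = c (SOME i. b = axis i 1)" for b
  have d: "d (axis i 1) = c i" for i
    by (simp add: d_def axis_eq_axis)
  have inj: "inj (\<lambda>i::'n. axis i (1::real))"
    by (simp add: inj_def axis_eq_axis)
  have Basis: "(Basis :: (real^'n) set) = (\<lambda>i. axis i 1) ` UNIV"
    by (auto simp: Basis_vec_def)
  have T: "(0 + (\<Sum>j\<in>Basis. (d j * (x \<bullet> j)) *\<^sub>R j)) = (\<chi> i. c i * x $ i)" for x
    unfolding Basis by (subst sum.reindex[OF inj]) (simp add: d vec_eq_iff inner_axis axis_nth_eq if_distrib cong: if_cong)
  have D: "(\<Prod>j\<in>(Basis :: (real^'n) set). \<bar>d j\<bar>) = \<bar>prod c UNIV\<bar>"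
    unfolding Basis by (subst prod.reindex[OF inj]) (simp add: d abs_prod)
  have "lborel = density (distr lborel borel (\<lambda>x::real^'n. \<chi> i. c i * x $ i)) (\<lambda>_. ennreal \<bar>prod c UNIV\<bar>)"
    unfolding T[symmetric] D[symmetric] by (rule lborel_affine_euclidean) (auto simp: Basis d c)
  moreover have [measurable]: "(\<lambda>x::real^'n. \<chi> i. c i * x $ i) \<in> borel_measurable borel"
    by (intro borel_measurable_continuous_onI continuous_intros)
  ultimately have "(\<integral>\<^sup>+x. h x \<partial>lborel) = (\<integral>\<^sup>+x. h x
      \<partial>density (distr lborel borel (\<lambda>x::real^'n. \<chi> i. c i * x $ i)) (\<lambda>_. ennreal \<bar>prod c UNIV\<bar>))"
    by simp
  then show ?thesis
    by (simp add: nn_integral_density nn_integral_distr nn_integral_cmult)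
qed

text \<open>Lebesgue measure is determined by its values on boxes, and exchanging two coordinates
  only permutes the side lengths.\<close>

lemma nn_integral_lborel_swap:
  fixes h :: "real^'n \<Rightarrow> ennreal"
  assumes [measurable]: "h \<in> borel_measurable borel"
  shows "(\<integral>\<^sup>+x. h x \<partial>lborel) = (\<integral>\<^sup>+x. h (\<chi> i. x $ Transposition.transpose m n i) \<partial>lborel)"
proof -
  let ?p = "Transposition.transpose m n"
  let ?T = "\<lambda>x::real^'n. \<chi> i. x $ ?p i"
  have [measurable]: "?T \<in> borel_measurable borel"
    by (intro borel_measurable_continuous_onI continuous_intros)
  have prod_Basis: "(\<Prod>b\<in>Basis. x \<bullet> b) = (\<Prod>i\<in>UNIV. x $ i)" for x :: "real^'n"
  proof -
    have inj: "inj (\<lambda>i::'n. axis i (1::real))"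
      by (simp add: inj_def axis_eq_axis)
    have Basis: "(Basis :: (real^'n) set) = (\<lambda>i. axis i 1) ` UNIV"
      by (auto simp: Basis_vec_def)
    show ?thesis
      unfolding Basis by (subst prod.reindex[OF inj]) (simp add: inner_axis)
  qed
  have "lborel = distr lborel borel ?T"
  proof (rule lborel_eqI)
    fix l u :: "real^'n" assume le: "\<And>b. b \<in> Basis \<Longrightarrow> l \<bullet> b \<le> u \<bullet> b"
    then have le': "l $ i \<le> u $ i" for i
      by (metis axis_in_Basis_iff cart_eq_inner_axis insert_iff Basis_real_def)
    have "?T -` box l u = box (?T l) (?T u)"
      by (auto simp: mem_box_cart) (metis transpose_involutory)+
    then have "emeasure (distr lborel borel ?T) (box l u) = emeasure lborel (box (?T l) (?T u))"
      by (simp add: emeasure_distr)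
    also have "\<dots> = (\<Prod>b\<in>Basis. (?T u - ?T l) \<bullet> b)"
      using le' by (intro emeasure_lborel_box) (auto simp: Basis_vec_def inner_axis)
    also have "(\<Prod>b\<in>Basis. (?T u - ?T l) \<bullet> b) = (\<Prod>b\<in>Basis. (u - l) \<bullet> b)"
      unfolding prod_Basis
      using prod.permute[of ?p UNIV "\<lambda>i. (u - l) $ i"]
      by (simp add: permutes_swap_id comp_def)
    finally show "emeasure (distr lborel borel ?T) (box l u) = (\<Prod>b\<in>Basis. (u - l) \<bullet> b)" .
  qed simp
  then have "(\<integral>\<^sup>+x. h x \<partial>lborel) = (\<integral>\<^sup>+x. h x \<partial>distr lborel borel ?T)"
    by simp
  then show ?thesis
    by (simp add: nn_integral_distr)
qed

text \<open>By Tonelli, integrate over coordinate \<open>m\<close> first. With the other coordinates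
  fixed, the shear is a translation by coordinate \<open>n\<close>, which preserves the
  one-dimensional integral.\<close>

lemma nn_integral_lborel_shear:
  fixes h :: "real^'n \<Rightarrow> ennreal"
  assumes mn: "m \<noteq> n" and [measurable]: "h \<in> borel_measurable borel"
  shows "(\<integral>\<^sup>+x. h x \<partial>lborel) = (\<integral>\<^sup>+x. h (\<chi> i. if i = m then x $ m + x $ n else x $ i) \<partial>lborel)"
proof -
  interpret product_sigma_finite "\<lambda>_::real^'n. lborel :: real measure"
    by standard
  let ?B = "Basis :: (real^'n) set"
  let ?m = "axis m 1 :: real^'n" and ?n = "axis n 1 :: real^'n"
  define C where "C = ?B - {?m}"
  have C: "finite C" "?m \<notin> C" "?B = insert ?m C"
    by (auto simp: C_def)
  let ?T = "\<lambda>x::real^'n. \<chi> i. if i = m then x $ m + x $ n else x $ i"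
  have T: "?T x = x + x $ n *\<^sub>R axis m 1" for x
    by (simp add: vec_eq_iff axis_def)
  \<comment> \<open>\<open>V\<close> assembles a vector from its coordinates; \<open>lborel\<close>
    is the image of the product measure under it.\<close>
  define V :: "(real^'n \<Rightarrow> real) \<Rightarrow> real^'n" where "V f = (\<Sum>b\<in>?B. f b *\<^sub>R b)" for f
  have V[measurable]: "V \<in> borel_measurable (Pi\<^sub>M ?B (\<lambda>_. lborel))"
    unfolding V_def by measurable
  have nn: "(\<integral>\<^sup>+x. g x \<partial>lborel) = (\<integral>\<^sup>+f. \<integral>\<^sup>+t. g (V (f(?m := t))) \<partial>lborel \<partial>Pi\<^sub>M C (\<lambda>_. lborel))"
    if [measurable]: "g \<in> borel_measurable borel" for g
  proof -
    have "(\<integral>\<^sup>+x. g x \<partial>lborel) = (\<integral>\<^sup>+f. g (V f) \<partial>Pi\<^sub>M ?B (\<lambda>_. lborel))"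
      by (subst lborel_eq) (simp add: nn_integral_distr V_def[symmetric] V_def[abs_def, symmetric])
    also have "\<dots> = (\<integral>\<^sup>+f. \<integral>\<^sup>+t. g (V (f(?m := t))) \<partial>lborel \<partial>Pi\<^sub>M C (\<lambda>_. lborel))"
      unfolding C(3) by (rule product_nn_integral_insert) (use C V in \<open>auto simp flip: C(3)\<close>)
    finally show ?thesis .
  qed
  have V_eq: "V (f(?m := t)) = t *\<^sub>R ?m + (\<Sum>b\<in>C. f b *\<^sub>R b)" for f t
    unfolding V_def C(3) using C(1,2) by (auto intro!: sum.cong)
  \<comment> \<open>As \<open>m \<noteq> n\<close>, the size of the shift is constant in the inner
    integral.\<close>
  have V_n: "V (f(?m := t)) $ n = f ?n" for f t
  proof -
    have "?n \<in> C"
      using mn by (auto simp: C_def axis_eq_axis)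
    have "V (f(?m := t)) $ n = V (f(?m := t)) \<bullet> ?n"
      by (simp add: inner_axis)
    also have "\<dots> = (\<Sum>b\<in>?B. (f(?m := t)) b * (b \<bullet> ?n))"
      by (simp add: V_def inner_sum_left)
    also have "\<dots> = (\<Sum>b\<in>?B. if b = ?n then (f(?m := t)) b else 0)"
      by (intro sum.cong) (auto simp: inner_Basis)
    also have "\<dots> = f ?n"
      using mn by (simp add: axis_eq_axis)
    finally show ?thesis .
  qed
  have T_V: "?T (V (f(?m := t))) = V (f(?m := f ?n + t))" for f t
    unfolding T unfolding V_n by (simp add: V_eq algebra_simps)
  have [measurable]: "?T \<in> borel_measurable borel"
    unfolding T by (intro borel_measurable_continuous_onI continuous_intros)
  have "(\<integral>\<^sup>+x. h (?T x) \<partial>lborel) = (\<integral>\<^sup>+f. \<integral>\<^sup>+t. h (V (f(?m := f ?n + t))) \<partial>lborel \<partial>Pi\<^sub>M C (\<lambda>_. lborel))"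
    by (subst nn) (simp_all add: T_V)
  also have "\<dots> = (\<integral>\<^sup>+f. \<integral>\<^sup>+t. h (V (f(?m := t))) \<partial>lborel \<partial>Pi\<^sub>M C (\<lambda>_. lborel))"
  proof (rule nn_integral_cong)
    fix f
    have "(\<lambda>t. h (V (f(?m := t)))) \<in> borel_measurable borel"
      unfolding V_eq by measurable
    from nn_integral_real_affine[OF this, of 1 "f ?n"]
    show "(\<integral>\<^sup>+t. h (V (f(?m := f ?n + t))) \<partial>lborel) = (\<integral>\<^sup>+t. h (V (f(?m := t))) \<partial>lborel)"
      by simp
  qed
  also have "\<dots> = (\<integral>\<^sup>+x. h x \<partial>lborel)"
    by (rule nn[OF assms(2), symmetric])
  finally show ?thesis ..
qed

text \<open>The library's linear change of variables demands a well-ordered index type;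
  the determinant formula holds for every finite one.\<close>

lemma nn_integral_lborel_linear:
  fixes f :: "real^'n \<Rightarrow> real^'n" and h :: "real^'n \<Rightarrow> ennreal"
  assumes f: "linear f" and "inj f" and "h \<in> borel_measurable borel"
  shows "(\<integral>\<^sup>+x. h x \<partial>lborel) = ennreal \<bar>det (matrix f)\<bar> * (\<integral>\<^sup>+x. h (f x) \<partial>lborel)"
proof -
  \<comment> \<open>Injectivity sits inside the induction predicate because the elementary maps
    include singular ones, for which \<open>P\<close> is vacuous.\<close>
  define P where "P f \<longleftrightarrow> (inj f \<longrightarrow> (\<forall>h \<in> borel_measurable borel.
    (\<integral>\<^sup>+x. h x \<partial>lborel) = ennreal \<bar>det (matrix f)\<bar> * (\<integral>\<^sup>+x. h (f x) \<partial>lborel)))"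
    for f :: "real^'n \<Rightarrow> real^'n"
  have "P f"
    using f
  proof (induction rule: induct_linear_elementary[of f P, consumes 1, case_names comp zeroes const swap idplus])
    case (comp f g)
    show ?case
      unfolding P_def
    proof (intro impI ballI)
      fix h :: "real^'n \<Rightarrow> ennreal" assume "inj (f \<circ> g)" and h[measurable]: "h \<in> borel_measurable borel"
      \<comment> \<open>In finite dimension the injective \<open>g\<close> is onto, so injectivity
        of the composite passes to \<open>f\<close> as well.\<close>
      then have "inj g"
        using inj_on_imageI2 by blast
      then have "surj g"
        using comp(2) linear_injective_imp_surjective by blast
      then have "inj f"
        using \<open>inj (f \<circ> g)\<close> \<open>inj g\<close> by (metis inj_on_image_iff comp_inj_on_iff)
      have "(\<lambda>x. h (f x)) \<in> borel_measurable borel"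
        using comp(1) by (intro measurable_compose[OF _ h] borel_measurable_continuous_onI linear_continuous_on)
          (simp add: linear_conv_bounded_linear)
      then have "(\<integral>\<^sup>+x. h (f x) \<partial>lborel) = ennreal \<bar>det (matrix g)\<bar> * (\<integral>\<^sup>+x. h (f (g x)) \<partial>lborel)"
        using comp(4) \<open>inj g\<close> unfolding P_def by blast
      moreover have "(\<integral>\<^sup>+x. h x \<partial>lborel) = ennreal \<bar>det (matrix f)\<bar> * (\<integral>\<^sup>+x. h (f x) \<partial>lborel)"
        using comp(3) \<open>inj f\<close> h unfolding P_def by blast
      ultimately show "(\<integral>\<^sup>+x. h x \<partial>lborel) = ennreal \<bar>det (matrix (f \<circ> g))\<bar> * (\<integral>\<^sup>+x. h ((f \<circ> g) x) \<partial>lborel)"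
        by (simp add: matrix_compose[OF comp(2,1)] det_mul abs_mult ennreal_mult' mult.assoc)
    qed
  next
    case (zeroes f i)
    have "axis i 1 \<notin> range f"
      using zeroes(2) by (metis axis_nth rangeE zero_neq_one)
    then have "\<not> inj f"
      using linear_injective_imp_surjective[OF zeroes(1)] by auto
    then show ?case
      by (simp add: P_def)
  next
    case (const c)
    show ?case
      unfolding P_def
    proof (intro impI ballI)
      fix h :: "real^'n \<Rightarrow> ennreal"
      assume inj: "inj (\<lambda>x::real^'n. \<chi> i. c i * x $ i)" and h: "h \<in> borel_measurable borel"
      have "c i \<noteq> 0" for i
      proof
        assume "c i = 0"
        then have "(\<chi> j. c j * axis i 1 $ j) = (\<chi> j. c j * (0::real^'n) $ j)"
          by (simp add: vec_eq_iff axis_def)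
        then show False
          using injD[OF inj, of "axis i 1" 0] by simp
      qed
      then show "(\<integral>\<^sup>+x. h x \<partial>lborel) = ennreal \<bar>det (matrix (\<lambda>x::real^'n. \<chi> i. c i * x $ i))\<bar>
          * (\<integral>\<^sup>+x. h (\<chi> i. c i * x $ i) \<partial>lborel)"
        using nn_integral_lborel_stretch[OF _ h, of c] by (simp add: matrix_def axis_def det_diagonal)
    qed
  next
    case (swap m n)
    let ?p = "Transposition.transpose m n"
    \<comment> \<open>The matrix is the identity with permuted rows, so its determinant is the sign
      of the permutation.\<close>
    have "matrix (\<lambda>x::real^'n. \<chi> i. x $ ?p i) = (\<chi> i. mat 1 $ ?p i)"
      by (simp add: matrix_def mat_def axis_def vec_eq_iff)
    then have "det (matrix (\<lambda>x::real^'n. \<chi> i. x $ ?p i)) = of_int (sign ?p)"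
      by (simp add: det_permute_rows permutes_swap_id)
    then have "\<bar>det (matrix (\<lambda>x::real^'n. \<chi> i. x $ ?p i))\<bar> = 1"
      by (simp add: sign_def)
    then show ?case
      using nn_integral_lborel_swap[of _ m n] by (simp add: P_def)
  next
    case (idplus m n)
    let ?T = "\<lambda>x::real^'n. \<chi> i. if i = m then x $ m + x $ n else x $ i"
    \<comment> \<open>Adding row \<open>n\<close> of the identity to row \<open>m\<close> keeps the
      determinant equal to 1.\<close>
    have "matrix ?T = (\<chi> k. if k = m then row m (mat 1) + 1 *s row n (mat 1) else row k (mat 1))"
      by (simp add: matrix_def mat_def axis_def row_def vec_eq_iff)
    then have "det (matrix ?T) = 1"
      using det_row_operation[OF idplus, of "mat 1 :: real^'n^'n" 1] by simp
    then show ?case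
      using nn_integral_lborel_shear[OF idplus] by (simp add: P_def)
  qed
  then show ?thesis
    using assms by (simp add: P_def)
qed

section \<open>Gaussian integrals\<close>

lemma nn_integral_std_gaussian_real:
  "(\<integral>\<^sup>+t. ennreal (exp (- (1/2) * (t::real)\<^sup>2)) \<partial>lborel) = ennreal (sqrt (2 * pi))"
proof -
  have eq: "exp (- (1/2) * t\<^sup>2) = sqrt (2 * pi) * std_normal_density t" for t :: real
    by (simp add: std_normal_density_def)
  show ?thesis
    unfolding eq by (subst nn_integral_eq_integral) auto
qed

lemma nn_integral_std_gaussian:
  "(\<integral>\<^sup>+x. ennreal (exp (- (1/2) * ((x::real^'n) \<bullet> x))) \<partial>lborel) = ennreal (sqrt ((2 * pi) ^ CARD('n)))"
proof -
  have "exp (- (1/2) * (x \<bullet> x)) = (\<Prod>b\<in>Basis. exp (- (1/2) * (x \<bullet> b)\<^sup>2))" for x :: "real^'n"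
    by (subst euclidean_inner)
       (simp add: exp_sum[symmetric] power2_eq_square sum_distrib_left sum_divide_distrib sum_negf)
  then have "(\<integral>\<^sup>+x. ennreal (exp (- (1/2) * ((x::real^'n) \<bullet> x))) \<partial>lborel)
      = (\<integral>\<^sup>+x. (\<Prod>b\<in>(Basis :: (real^'n) set). ennreal (exp (- (1/2) * (x \<bullet> b)\<^sup>2))) \<partial>lborel)"
    by (simp add: prod_ennreal)
  also have "\<dots> = (\<Prod>b\<in>(Basis :: (real^'n) set). ennreal (sqrt (2 * pi)))"
    by (subst nn_integral_lborel_prod) (simp_all only: nn_integral_std_gaussian_real, auto)
  also have "\<dots> = ennreal (sqrt ((2 * pi) ^ CARD('n)))"
    unfolding real_sqrt_power by (simp add: ennreal_power)
  finally show ?thesis .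
qed

text \<open>The determinant is the square of that of the root, and invertibility makes it
  nonzero.\<close>

lemma sym_pos_def_det_pos:
  assumes "sym_pos_def A"
  shows "det A > 0"
proof -
  have "det A = (det (matrix_sqrt A))\<^sup>2"
    by (metis assms det_mul matrix_sqrt_square power2_eq_square)
  moreover have "det A \<noteq> 0"
    using sym_pos_def_invertible[OF assms] by (simp add: invertible_det_nz)
  ultimately show ?thesis
    by simp
qed

text \<open>The substitution by the root \<open>S\<close> of \<open>P\<close> has Jacobian
  \<open>sqrt (det P)\<close> and reduces the form to \<open>z \<bullet> z\<close>; translation
  invariance restores the mean. Starting from the nonnegative integral yields integrability and
  value together.\<close>

lemma has_bochner_integral_gaussian:
  fixes m :: "real^'n"
  assumes P: "sym_pos_def P"
  shows "has_bochner_integral lebesgue (\<lambda>x. exp (- (1/2) * ((x - m) \<bullet> (matrix_inv P *v (x - m)))))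
    (sqrt ((2 * pi) ^ CARD('n) * det P))"
proof -
  define S where "S = matrix_sqrt P"
  have S: "sym_pos_def S" "S ** S = P"
    unfolding S_def by (simp_all add: P sym_pos_def_matrix_sqrt matrix_sqrt_square)
  define q where "q x = exp (- (1/2) * (x \<bullet> (matrix_inv P *v x)))" for x
  have cont: "continuous_on UNIV (\<lambda>x. matrix_inv P *v x)"
    by (simp add: linear_continuous_on linear_conv_bounded_linear)
  have q[measurable]: "q \<in> borel_measurable borel"
    unfolding q_def
    by (intro borel_measurable_continuous_onI continuous_intros cont)
  have qS: "q (S *v z) = exp (- (1/2) * (z \<bullet> z))" for z
  proof -
    \<comment> \<open>Then \<open>S *v z = P *v z'\<close>, so the inverse of \<open>P\<close>
      cancels, and symmetry of \<open>S\<close> moves it across the inner product.\<close>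
    obtain z' where z: "z = S *v z'"
      by (metis sym_pos_def_mult_inv_vector[OF S(1)])
    have "matrix_inv P *v (S *v z) = z'"
      unfolding z by (metis S(2) matrix_vector_mul_assoc sym_pos_def_inv_mult_vector[OF P])
    with z show ?thesis
      by (simp add: q_def inner_matrix_vector_symmetric[OF sym_pos_def_transpose[OF S(1)]])
  qed
  have "inj ((*v) S)"
    using S(1) inj_matrix_vector_mult sym_pos_def_invertible by blast
  then have "(\<integral>\<^sup>+x. ennreal (q x) \<partial>lborel) = ennreal \<bar>det S\<bar> * ennreal (sqrt ((2 * pi) ^ CARD('n)))"
    using nn_integral_lborel_linear[OF matrix_vector_mul_linear _ measurable_compose[OF q measurable_ennreal], of S]
    unfolding qS nn_integral_std_gaussian by (simp only: matrix_of_matrix_vector_mul)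
  also have "\<dots> = ennreal (sqrt ((2 * pi) ^ CARD('n) * det P))"
    by (simp add: S(2)[symmetric] det_mul real_sqrt_mult ennreal_mult mult.commute)
  finally have "(\<integral>\<^sup>+x. ennreal (q x) \<partial>lborel) = ennreal (sqrt ((2 * pi) ^ CARD('n) * det P))" .
  moreover have "(\<integral>\<^sup>+x. ennreal (q x) \<partial>lborel) = (\<integral>\<^sup>+x. ennreal (q x) \<partial>distr lborel borel ((+) (- m)))"
    by (simp add: lborel_distr_plus)
  ultimately have "(\<integral>\<^sup>+x. ennreal (q (x - m)) \<partial>lborel) = ennreal (sqrt ((2 * pi) ^ CARD('n) * det P))"
    by (simp add: nn_integral_distr)
  moreover have "(\<lambda>x. q (x - m)) \<in> borel_measurable borel"
    by measurable
  ultimately have "has_bochner_integral lborel (\<lambda>x. q (x - m)) (sqrt ((2 * pi) ^ CARD('n) * det P))"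
    using sym_pos_def_det_pos[OF P]
    by (intro has_bochner_integral_nn_integral) (auto simp: q_def)
  then have "has_bochner_integral lebesgue (\<lambda>x. q (x - m)) (sqrt ((2 * pi) ^ CARD('n) * det P))"
    by (simp add: has_bochner_integral_iff integrable_completion integral_completion)
  then show ?thesis
    by (simp add: q_def)
qed

text \<open>The constant \<open>c\<close> cancels in the quotient, so a posterior is identified by
  its exponent up to an additive constant.\<close>

lemma gauss_density_normalised:
  fixes m :: "real^'n"
  assumes P: "sym_pos_def P" and "c \<noteq> 0"
    and f: "\<And>x. f x = c * exp (- (1/2) * ((x - m) \<bullet> (matrix_inv P *v (x - m))))"
  shows "f x / integral\<^sup>L lebesgue f = gauss_density x m P"
proof -
  have "f = (\<lambda>x. c * exp (- (1/2) * ((x - m) \<bullet> (matrix_inv P *v (x - m)))))"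
    using f by blast
  then have "integral\<^sup>L lebesgue f = c * sqrt ((2 * pi) ^ CARD('n) * det P)"
    using has_bochner_integral_integral_eq[OF has_bochner_integral_gaussian[OF P, of m]] by simp
  then show ?thesis
    using \<open>c \<noteq> 0\<close> by (simp add: f gauss_density_def)
qed

section \<open>The score matching estimator of a Gaussian likelihood\<close>

lemma grad_eqI:
  assumes "(f has_derivative (\<lambda>h. g \<bullet> h)) (at y)"
  shows "grad f y = g"
  using frechet_derivative_at[OF assms, symmetric] by (simp add: grad_def vec_eq_iff inner_axis)

lemma has_derivative_grad:
  fixes f :: "real^'n \<Rightarrow> real"
  assumes "f differentiable at y"
  shows "(f has_derivative (\<lambda>h. grad f y \<bullet> h)) (at y)"
proof -
  let ?D = "frechet_derivative f (at y)"
  have D: "(f has_derivative ?D) (at y)"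
    using assms by (simp add: frechet_derivative_works)
  then interpret linear ?D
    by (rule has_derivative_linear)
  have "?D h = grad f y \<bullet> h" for h
  proof -
    have "?D h = ?D (\<Sum>i\<in>UNIV. h $ i *\<^sub>R axis i 1)"
      by (simp add: basis_expansion flip: scalar_mult_eq_scaleR)
    also have "\<dots> = grad f y \<bullet> h"
      by (simp add: sum scaleR grad_def inner_vec_def mult.commute)
    finally show ?thesis .
  qed
  then have "?D = (\<lambda>h. grad f y \<bullet> h)"
    by blast
  with D show ?thesis
    by simp
qed

text \<open>The normalising constant becomes an additive constant under \<open>ln\<close>. Symmetry
  of the inverse merges the two product-rule terms, which cancels the factor 1/2.\<close>

lemma score_gauss_density:
  fixes m :: "real^'n"
  assumes R: "sym_pos_def R"
  shows "score (\<lambda>z. gauss_density z m R) y = - (matrix_inv R *v (y - m))"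
proof -
  let ?A = "matrix_inv R" and ?c = "sqrt ((2 * pi) ^ CARD('n) * det R)"
  have "?c > 0"
    using sym_pos_def_det_pos[OF R] by simp
  then have ln: "ln (gauss_density z m R) = - (1/2) * ((z - m) \<bullet> (?A *v (z - m))) - ln ?c" for z
    unfolding gauss_density_def by (subst ln_div) auto
  have A: "((\<lambda>z. ?A *v (z - m)) has_derivative (\<lambda>h. ?A *v h)) (at y)"
    by (auto intro!: derivative_eq_intros bounded_linear.has_derivative[OF matrix_vector_mul_bounded_linear])
  have A_sym: "(y - m) \<bullet> (?A *v h) = (?A *v (y - m)) \<bullet> h" for h
    by (simp add: inner_matrix_vector_symmetric sym_pos_def_transpose[OF sym_pos_def_matrix_inv[OF R]])
  have "((\<lambda>z. (z - m) \<bullet> (?A *v (z - m))) has_derivative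
      (\<lambda>h. (y - m) \<bullet> (?A *v h) + h \<bullet> (?A *v (y - m)))) (at y)"
    by (intro has_derivative_inner A) (auto intro!: derivative_eq_intros)
  then have "((\<lambda>z. ln (gauss_density z m R)) has_derivative
      (\<lambda>h. - (1/2) * ((y - m) \<bullet> (?A *v h) + h \<bullet> (?A *v (y - m))) - 0)) (at y)"
    unfolding ln by (intro has_derivative_diff has_derivative_mult_right has_derivative_const)
  then have "((\<lambda>z. ln (gauss_density z m R)) has_derivative (\<lambda>h. (- (?A *v (y - m))) \<bullet> h)) (at y)"
    unfolding A_sym inner_commute[of _ "?A *v (y - m)"] by simp
  then show ?thesis
    unfolding score_def by (rule grad_eqI)
qed

text \<open>Product rule; the dimension appears as the trace of the identity, the derivative of
  \<open>z - m\<close>.\<close>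

lemma divergence_scaleR_diff:
  fixes m :: "real^'n"
  assumes "f differentiable at y"
  shows "divergence (\<lambda>z. f z *\<^sub>R (z - m)) y = grad f y \<bullet> (y - m) + real CARD('n) * f y"
proof -
  have "((\<lambda>z. f z *\<^sub>R (z - m)) has_derivative (\<lambda>h. f y *\<^sub>R h + (grad f y \<bullet> h) *\<^sub>R (y - m))) (at y)"
    by (auto intro!: derivative_eq_intros has_derivative_grad assms)
  from frechet_derivative_at[OF this, symmetric] show ?thesis
    by (simp add: divergence_def inner_axis sum.distrib inner_vec_def[of _ "y - m"])
qed

lemma dsm_gauss:
  fixes k :: "real^'n \<Rightarrow> real"
  assumes R: "sym_pos_def R" and k: "k differentiable at y"
  shows "dsm (\<lambda>z. k z *\<^sub>R matrix_sqrt R) (\<lambda>x z. gauss_density z (\<mu> x) R) x y =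
    (k y)\<^sup>2 * ((y - \<mu> x) \<bullet> (matrix_inv R *v (y - \<mu> x)))
    - 2 * (grad (\<lambda>z. (k z)\<^sup>2) y \<bullet> (y - \<mu> x)) - 2 * real CARD('n) * (k y)\<^sup>2"
proof -
  define S where "S = matrix_sqrt R"
  have S: "transpose S = S" "S ** S = R"
    unfolding S_def by (simp_all add: R sym_pos_def_transpose sym_pos_def_matrix_sqrt matrix_sqrt_square)
  have Sv: "S *v (S *v v) = R *v v" for v
    by (simp add: matrix_vector_mul_assoc S)
  have wT: "transpose (k z *\<^sub>R S) = k z *\<^sub>R S" for z
    by (simp add: transpose_scalar S)
  have kS: "(k z *\<^sub>R S) *v v = k z *\<^sub>R (S *v v)" for z v
    by (simp add: scaleR_matrix_vector_assoc)
  let ?v = "y - \<mu> x"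
  have "(norm (S *v (matrix_inv R *v ?v)))\<^sup>2 = ?v \<bullet> (matrix_inv R *v ?v)"
    unfolding power2_norm_eq_inner inner_matrix_vector_symmetric[OF S(1)] Sv sym_pos_def_mult_inv_vector[OF R] by (rule inner_commute)
  then have 1: "(norm ((k y *\<^sub>R S) *v (- (matrix_inv R *v ?v))))\<^sup>2 = (k y)\<^sup>2 * (?v \<bullet> (matrix_inv R *v ?v))"
    unfolding kS by (simp add: power_mult_distrib vec.neg)
  \<comment> \<open>The two roots multiply to \<open>R\<close> and cancel its inverse in the score,
    leaving a scalar multiple of \<open>z - \<mu> x\<close>, the shape covered by the divergence
    formula.\<close>
  have 2: "(k z *\<^sub>R S ** k z *\<^sub>R S) *v (- (matrix_inv R *v (z - \<mu> x))) = (- (k z)\<^sup>2) *\<^sub>R (z - \<mu> x)" for z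
    by (simp add: kS vec.neg matrix_vector_mult_scaleR Sv sym_pos_def_mult_inv_vector[OF R] power2_eq_square
        flip: matrix_vector_mul_assoc)
  have k2: "(\<lambda>z. (k z)\<^sup>2) differentiable at y"
    using k by (intro differentiable_power)
  have "grad (\<lambda>z. - (k z)\<^sup>2) y = - grad (\<lambda>z. (k z)\<^sup>2) y"
    by (rule grad_eqI) (use has_derivative_minus[OF has_derivative_grad[OF k2]] in simp)
  then have "divergence (\<lambda>z. (- (k z)\<^sup>2) *\<^sub>R (z - \<mu> x)) y
      = - (grad (\<lambda>z. (k z)\<^sup>2) y \<bullet> ?v) - real CARD('n) * (k y)\<^sup>2"
    using k2 by (subst divergence_scaleR_diff) auto
  then show ?thesis
    unfolding dsm_def score_gauss_density[OF R] S_def[symmetric] wT 1 2 by simp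
qed

section \<open>The Kalman update\<close>

lemma inner_transpose_matrix_vector:
  fixes H :: "real^'m^'n"
  shows "u \<bullet> (transpose H *v z) = (H *v u) \<bullet> z"
  by (metis dot_lmul_matrix inner_commute transpose_matrix_vector)

lemma sym_pos_def_add:
  assumes "sym_pos_def A" "transpose B = B" "\<And>v. v \<bullet> (B *v v) \<ge> 0"
  shows "sym_pos_def (A + B)"
proof -
  have "transpose (A + B) = A + B"
    using assms(2) sym_pos_def_transpose[OF assms(1)] by (simp add: transpose_def vec_eq_iff)
  then show ?thesis
    using assms(3) sym_pos_def_inner_pos[OF assms(1)]
    by (simp add: sym_pos_def_def matrix_vector_mult_add_rdistrib inner_add_right add_pos_nonneg)
qed

text \<open>Serves twice: for the information matrix, and with \<open>transpose H\<close> in place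
  of \<open>H\<close> for the innovation covariance.\<close>

lemma sym_pos_def_add_congruence:
  fixes A :: "real^'n^'n" and B :: "real^'m^'m" and H :: "real^'n^'m"
  assumes A: "sym_pos_def A" and B: "sym_pos_def B"
  shows "sym_pos_def (A + transpose H ** B ** H)"
proof (rule sym_pos_def_add[OF A])
  show "transpose (transpose H ** B ** H) = transpose H ** B ** H"
    by (simp add: matrix_transpose_mul matrix_mul_assoc sym_pos_def_transpose[OF B])
  show "v \<bullet> ((transpose H ** B ** H) *v v) \<ge> 0" for v
    using sym_pos_def_inner_nonneg[OF B, of "H *v v"]
    by (simp add: inner_transpose_matrix_vector del: transpose_matrix_vector flip: matrix_vector_mul_assoc)
qed

text \<open>\<open>K\<close> is the Kalman gain, \<open>Pa\<close> the updated covariance and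
  \<open>Q\<close> the information matrix of the update with observation covariance
  \<open>N\<close>.\<close>

context
  fixes P :: "real^'n^'n" and N :: "real^'m^'m" and H :: "real^'n^'m"
    and K :: "real^'m^'n" and Pa Q :: "real^'n^'n"
  assumes P: "sym_pos_def P" and N: "sym_pos_def N"
  defines "K \<equiv> P ** transpose H ** matrix_inv (N + H ** P ** transpose H)"
    and "Pa \<equiv> P - K ** H ** P"
    and "Q \<equiv> matrix_inv P + transpose H ** matrix_inv N ** H"
begin

text \<open>Push-through identity: with \<open>z\<close> solving \<open>(N + H P H^T) z = e\<close>,
  one has \<open>K e = P H^T z\<close>, and
  \<open>Q P H^T z = H^T N^-1 (N + H P H^T) z\<close>.\<close>

lemma kalman_information_gain: "Q *v (K *v e) = transpose H *v (matrix_inv N *v e)"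
proof -
  let ?M = "N + H ** P ** transpose H"
  define z where "z = matrix_inv ?M *v e"
  define G where "G = transpose H"
  have "sym_pos_def ?M"
    using sym_pos_def_add_congruence[OF N P, of "transpose H"] by simp
  then have "?M *v z = e"
    by (simp add: z_def matrix_vector_mul_assoc matrix_inv_right sym_pos_def_invertible)
  then have e: "N *v z + H *v (P *v (G *v z)) = e"
    by (simp add: G_def matrix_vector_mult_add_rdistrib matrix_vector_mul_assoc matrix_mul_assoc del: transpose_matrix_vector)
  have "K *v e = P *v (G *v z)"
    by (simp add: K_def z_def G_def matrix_vector_mul_assoc matrix_mul_assoc del: transpose_matrix_vector)
  then have "Q *v (K *v e) = matrix_inv P *v (P *v (G *v z)) + G *v (matrix_inv N *v (H *v (P *v (G *v z))))"
    by (simp add: Q_def G_def[symmetric] matrix_vector_mult_add_rdistrib flip: matrix_vector_mul_assoc)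
  also have "matrix_inv P *v (P *v (G *v z)) = G *v z"
    by (rule sym_pos_def_inv_mult_vector[OF P])
  also have "G *v z + G *v (matrix_inv N *v (H *v (P *v (G *v z)))) = G *v (matrix_inv N *v e)"
    by (simp add: vec.add sym_pos_def_inv_mult_vector[OF N] flip: e)
  finally show ?thesis
    by (simp add: G_def)
qed

lemma sym_pos_def_information: "sym_pos_def Q"
  unfolding Q_def by (intro sym_pos_def_add_congruence sym_pos_def_matrix_inv P N)

text \<open>Woodbury identity: in \<open>Q Pa = Q P - (Q K) H P\<close> the gain identity makes the
  subtracted term cancel all of \<open>Q P\<close> except the identity.\<close>

lemma matrix_inv_information: "matrix_inv Q = Pa"
proof (rule matrix_inv_unique)
  define G where "G = transpose H"
  have "Q *v (Pa *v v) = v" for v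
  proof -
    have "Pa *v v = P *v v - K *v (H *v (P *v v))"
      by (simp add: Pa_def matrix_vector_mult_diff_rdistrib flip: matrix_vector_mul_assoc)
    then have "Q *v (Pa *v v) = Q *v (P *v v) - G *v (matrix_inv N *v (H *v (P *v v)))"
      by (simp add: vec.diff kalman_information_gain G_def del: transpose_matrix_vector)
    also have "Q *v (P *v v) = matrix_inv P *v (P *v v) + G *v (matrix_inv N *v (H *v (P *v v)))"
      by (simp add: Q_def G_def[symmetric] matrix_vector_mult_add_rdistrib flip: matrix_vector_mul_assoc)
    also have "matrix_inv P *v (P *v v) = v"
      by (rule sym_pos_def_inv_mult_vector[OF P])
    finally show ?thesis
      by simp
  qed
  then show "Q ** Pa = mat 1"
    by (simp add: matrix_eq flip: matrix_vector_mul_assoc)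
qed

text \<open>Positivity is hard to see from the difference defining \<open>Pa\<close>, but is
  inherited from its inverse \<open>Q\<close>.\<close>

lemma sym_pos_def_kalman_covariance: "sym_pos_def Pa"
  using sym_pos_def_matrix_inv[OF sym_pos_def_information] by (simp add: matrix_inv_information)

lemma matrix_inv_kalman_covariance: "matrix_inv Pa = Q"
  by (metis matrix_inv_information matrix_inv_left matrix_inv_unique sym_pos_def_information
      sym_pos_def_invertible)

text \<open>As a function of \<open>u\<close> the left side has quadratic part \<open>Q\<close> and
  linear part given by \<open>H^T N^-1 e\<close>, which is \<open>Q K e\<close>; so its minimiser is
  \<open>K e\<close>, and the last bracket is the minimum, free of \<open>u\<close>.\<close>

lemma kalman_complete_square:
  "u \<bullet> (matrix_inv P *v u) + (e - H *v u) \<bullet> (matrix_inv N *v (e - H *v u)) =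
    (u - K *v e) \<bullet> (matrix_inv Pa *v (u - K *v e))
    + (e \<bullet> (matrix_inv N *v e) - (H *v (K *v e)) \<bullet> (matrix_inv N *v e))"
proof -
  note simps = inner_transpose_matrix_vector kalman_information_gain vec.diff inner_diff_left inner_diff_right
  have N_sym: "v \<bullet> (matrix_inv N *v v') = v' \<bullet> (matrix_inv N *v v)" for v v'
    by (metis N inner_commute inner_matrix_vector_symmetric sym_pos_def_matrix_inv sym_pos_def_transpose)
  have "(K *v e) \<bullet> (Q *v u) = (Q *v (K *v e)) \<bullet> u"
    by (metis inner_matrix_vector_symmetric sym_pos_def_information sym_pos_def_transpose)
  then have "(K *v e) \<bullet> (Q *v u) = (H *v u) \<bullet> (matrix_inv N *v e)"
    by (metis inner_commute inner_transpose_matrix_vector kalman_information_gain)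
  moreover have "u \<bullet> (Q *v u) = u \<bullet> (matrix_inv P *v u) + (H *v u) \<bullet> (matrix_inv N *v (H *v u))"
    by (simp add: Q_def matrix_vector_mult_add_rdistrib inner_add_right inner_transpose_matrix_vector
        del: transpose_matrix_vector flip: matrix_vector_mul_assoc)
  ultimately show ?thesis
    unfolding matrix_inv_kalman_covariance
    using N_sym[of e "H *v u"]
    by (simp add: simps del: transpose_matrix_vector)
qed

end

theorem proposition1:
  fixes mf :: "real^'dx"
    and Pf :: "real^'dx^'dx"
    and H :: "real^'dx^'dy"
    and R :: "real^'dy^'dy"
    and k :: "real^'dy \<Rightarrow> real"
    and w :: "real^'dy \<Rightarrow> real^'dy^'dy"
    and prior :: "real^'dx \<Rightarrow> real"
    and lik :: "real^'dx \<Rightarrow> real^'dy \<Rightarrow> real"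
    and \<pi> :: "real^'dy \<Rightarrow> real"
    and y :: "real^'dy"
  assumes Pf: "sym_pos_def Pf"
    and R: "sym_pos_def R"
    and prior: "prior = (\<lambda>x. gauss_density x mf Pf)"
    and lik: "lik = (\<lambda>x z. gauss_density z (H *v x) R)"
    and k_range: "\<And>z. 0 < k z \<and> k z \<le> 1"
    and k_diff: "\<And>z. k differentiable at z"
    and w: "w = (\<lambda>z. k z *\<^sub>R matrix_sqrt R)"
    and \<pi>_density: "prob_density \<pi>"
    and \<pi>_regular: "dsm_regular \<pi> w lik"
  shows "let N = (1 / (2 * (k y)\<^sup>2)) *\<^sub>R R;
             yt = y - 2 *\<^sub>R (N *v grad (\<lambda>z. (k z)\<^sup>2) y);
             K = Pf ** transpose H ** matrix_inv (N + H ** Pf ** transpose H);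
             Pa = Pf - K ** H ** Pf;
             ma = mf - K *v (H *v mf - yt)
         in sym_pos_def Pa \<and> (\<forall>x. dsm_posterior prior w lik y x = gauss_density x ma Pa)"
proof -
  define N where "N = (1 / (2 * (k y)\<^sup>2)) *\<^sub>R R"
  define g where "g = grad (\<lambda>z. (k z)\<^sup>2) y"
  define yt where "yt = y - 2 *\<^sub>R (N *v g)"
  define K where "K = Pf ** transpose H ** matrix_inv (N + H ** Pf ** transpose H)"
  define Pa where "Pa = Pf - K ** H ** Pf"
  define ma where "ma = mf - K *v (H *v mf - yt)"
  have ky: "k y > 0"
    using k_range by blast
  have Nv: "N *v v = (1 / (2 * (k y)\<^sup>2)) *\<^sub>R (R *v v)" for v
    by (simp add: N_def scaleR_matrix_vector_assoc)
  have N: "sym_pos_def N"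
    using R ky by (simp add: sym_pos_def_def Nv) (simp add: N_def transpose_scalar)
  \<comment> \<open>The factor 1/2 in \<open>N\<close> makes half the form of its inverse equal to
    \<open>(k y)^2\<close> times that of \<open>matrix_inv R\<close>.\<close>
  have "N ** ((2 * (k y)\<^sup>2) *\<^sub>R matrix_inv R) = mat 1"
    using ky R by (simp add: N_def matrix_scalar_ac scalar_matrix_assoc matrix_inv_right sym_pos_def_invertible
        flip: scalar_mult_eq_scaleR)
  then have invN: "matrix_inv N = (2 * (k y)\<^sup>2) *\<^sub>R matrix_inv R"
    by (rule matrix_inv_unique)
  have Pa: "sym_pos_def Pa"
    unfolding Pa_def K_def by (rule sym_pos_def_kalman_covariance[OF Pf N])
  \<comment> \<open>\<open>e\<close> is the innovation at the prior mean; \<open>c\<close> gathers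
    the terms of the exponent that do not depend on \<open>x\<close>, including the remainder of the
    completed square.\<close>
  define e where "e = yt - H *v mf"
  define c where "c = - (1/2) * (e \<bullet> (matrix_inv N *v e) - (H *v (K *v e)) \<bullet> (matrix_inv N *v e))
    + 2 * (g \<bullet> (N *v g)) + 2 * real CARD('dy) * (k y)\<^sup>2"
  \<comment> \<open>The gradient term of the divergence is linear in the innovation, so it is absorbed
    by replacing the observation \<open>y\<close> with \<open>yt\<close>.\<close>
  have dsm: "dsm w lik x y = (1/2) * ((yt - H *v x) \<bullet> (matrix_inv N *v (yt - H *v x)))
      - 2 * (g \<bullet> (N *v g)) - 2 * real CARD('dy) * (k y)\<^sup>2" for x
  proof -
    define v where "v = y - H *v x"
    have inv: "matrix_inv N *v (N *v g) = g"
      by (rule sym_pos_def_inv_mult_vector[OF N])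
    have Ng: "(N *v g) \<bullet> (matrix_inv N *v v) = g \<bullet> v"
      by (metis N inv inner_matrix_vector_symmetric sym_pos_def_matrix_inv sym_pos_def_transpose)
    have yt: "yt - H *v x = v - 2 *\<^sub>R (N *v g)"
      by (simp add: yt_def v_def)
    \<comment> \<open>The shift by \<open>2 N g\<close> creates the cross term
      \<open>- 2 (g \<bullet> v)\<close> of the estimator, at the cost of a term constant in
      \<open>x\<close>.\<close>
    have "(1/2) * ((yt - H *v x) \<bullet> (matrix_inv N *v (yt - H *v x)))
        = (1/2) * (v \<bullet> (matrix_inv N *v v)) - 2 * (g \<bullet> v) + 2 * (g \<bullet> (N *v g))"
      unfolding yt
      by (simp add: matrix_vector_mult_diff_distrib matrix_vector_mult_scaleR inv Ng inner_diff_left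
          inner_diff_right inner_commute[of _ g] field_simps)
    moreover have "(1/2) * (v \<bullet> (matrix_inv N *v v)) = (k y)\<^sup>2 * (v \<bullet> (matrix_inv R *v v))"
      by (simp add: invN flip: scaleR_matrix_vector_assoc)
    ultimately show ?thesis
      unfolding w lik using dsm_gauss[OF R k_diff, of "\<lambda>x. H *v x" x y] unfolding g_def v_def by linarith
  qed
  have "prior x * exp (- dsm w lik x y) = exp c / sqrt ((2 * pi) ^ CARD('dx) * det Pf) *
      exp (- (1/2) * ((x - ma) \<bullet> (matrix_inv Pa *v (x - ma))))" for x
  proof -
    \<comment> \<open>Here \<open>p\<close> and \<open>q\<close> stand for the prior and observation
      forms, \<open>a\<close> for the posterior form, \<open>b\<close> for the remainder of the
      completed square.\<close>
    have lin_eq: "- (1/2) * p + - (1/2 * q - s - t) = - (1/2) * b + s + t + - (1/2) * a"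
      if "p + q = a + b" for p q a b s t :: real
      using that by simp
    \<comment> \<open>The square is completed in the centred variable \<open>x - mf\<close>; in
      these terms \<open>ma = mf + K *v e\<close>.\<close>
    have eqs: "e - H *v (x - mf) = yt - H *v x" "x - mf - K *v e = x - ma"
      by (simp_all add: e_def ma_def matrix_vector_mult_diff_distrib)
    have "- (1/2) * ((x - mf) \<bullet> (matrix_inv Pf *v (x - mf))) + - dsm w lik x y
        = c + - (1/2) * ((x - ma) \<bullet> (matrix_inv Pa *v (x - ma)))"
      using kalman_complete_square[OF Pf N, of "x - mf" e H, folded K_def Pa_def] unfolding eqs dsm c_def
      by (rule lin_eq)
    then show ?thesis
      unfolding prior gauss_density_def by (simp only: times_divide_eq_left exp_add[symmetric])
  qed
  then have "dsm_posterior prior w lik y x = gauss_density x ma Pa" for x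
    unfolding dsm_posterior_def
    using sym_pos_def_det_pos[OF Pf]
    by (intro gauss_density_normalised[OF Pa, of "exp c / sqrt ((2 * pi) ^ CARD('dx) * det Pf)"]) auto
  with Pa show ?thesis
    by (simp add: Let_def flip: N_def g_def yt_def K_def Pa_def ma_def)
qed

end
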